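(* Let $N$ be the event-activity network of a line network $(G,\mathcal L)$, let $T\in\mathbb N$ be a period, let $l,u\in\mathbb Z^{A(N)}$ with $l\le u$, and let $\omega\in\mathbb Q^{A(N)}$. Let $o^\star(\mathrm{cXPESP}_{IP})$ and $o^\star(\mathrm{cXPESP}_{LP})$ be the optimal values of the integer program cXPESP and of its linear programming relaxation, and for $L\in\mathcal L$ let $o(\mathrm{cXPESP}_{IP})_L$ be the optimal value of the integer program cXPESP restricted to the single line $L$. The optimal objective value of the linear programming relaxation decomposes into the contribution of the cycle variables, which can be grouped into the lines, and of the transfer arc variables, and for an optimal solution $(x,z)$ of the linear programming relaxation $$o^\star(\mathrm{cXPESP}_{LP})=\sum_{c\in C}\vartheta_cx_c+\sum_{a\in Z(D)}\omega_a\tau_az_a\ \ge\ \sum_{L\in\mathcal L}\sum_{c\in C_L}\vartheta_cx_c+\sum_{\alpha\in Z(N)}\omega_\alpha l_\alpha.$$ For each $L\in\mathcal L$, the optimal value of the linear programming relaxation of the problem restricted to $L$ coincides with the optimal value $o(\mathrm{cXPESP}_{IP})_L$ of its integer program. An optimal solution attaining $o^\star(\mathrm{cXPESP}_{LP})$ does not have to include the optimal solution for each individual line; instead $o^\star(\mathrm{cXPESP}_{LP})$ is bounded by them from below, such that $$o^\star(\mathrm{cXPESP}_{IP})\ \ge\ o^\star(\mathrm{cXPESP}_{LP})\ \ge\ \sum_{L\in\mathcal L}o(\mathrm{cXPESP}_{IP})_L+\sum_{\alpha\in Z(N)}\omega_\alpha l_\alpha.$$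
   Context: **Event-activity network.** A line network is a finite undirected graph $G$ with a finite set $\mathcal L$ of lines, each line $L=(v_1,\dots,v_n)$ being a path in $G$ with at least one edge. The event-activity network $N$ is the directed graph whose nodes are called events and whose arcs are called activities. For each line $L=(v_1,\dots,v_n)$ and each $1\le i\le n-1$ it has events $(v_i,L,dep,+)$, $(v_{i+1},L,arr,+)$, $(v_{i+1},L,dep,-)$, $(v_i,L,arr,-)$ and driving activities $((v_i,L,dep,+),(v_{i+1},L,arr,+))$, $((v_{i+1},L,dep,-),(v_i,L,arr,-))$; for each stop $v$ of $L$ and $s\in\{+,-\}$ a waiting activity $((v,L,arr,s),(v,L,dep,s))$ if both events exist; turnaround activities $((v_1,L,arr,-),(v_1,L,dep,+))$ and $((v_n,L,arr,+),(v_n,L,dep,-))$; and for every ordered pair of distinct lines $L,L'$, every common stop $v$ and $s_1,s_2\in\{+,-\}$ a transfer activity $((v,L,arr,s_1),(v,L',dep,s_2))$ if both events exist. $V(N),A(N)$ are the sets of events and activities, $Z(N)$ the set of transfer activities. The line cycle $\gamma_L$ is the directed cycle in $N$ formed by all events and all driving, waiting and turnaround activities of $L$. **Expanded network.** $[T]=\{0,\dots,T-1\}$, and $k \bmod T\in[T]$. $V(D)=\{v[t] : v\in V(N),t\in[T]\}$. For $\alpha=(v,w)\in A(N)$ let $\mathcal A(\alpha)=\{(v[t],w[t']) : t,t'\in[T],\ (t'-t-l_\alpha)\bmod T\le u_\alpha-l_\alpha\}$, and $A(D)=\bigcup_\alpha \mathcal A(\alpha)$. The duration of $a=(v[t],w[t'])\in\mathcal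 A(\alpha)$ is $\tau_a=((t'-t-l_\alpha)\bmod T)+l_\alpha$, its weight is $\omega_a=\omega_\alpha$. $Z(D)=\bigcup_{\alpha\in Z(N)}\mathcal A(\alpha)$. $\delta^{+}_{S}(v)$, $\delta^-_S(v)$ are the outgoing, respectively ingoing, arcs of $v$ in $S\subseteq A(D)$. The expanded line cycle of $L$ is $D$ restricted to the nodes $v[t]$ with $v\in V(\gamma_L)$, $t\in[T]$. A cycle of $L$ is a closed (directed, simple) path $c$ in the expanded line cycle with $|V(c)|=|V(\gamma_L)|$; $C_L$ is the set of cycles of $L$, $C=\bigcup_{L}C_L$, and $\vartheta_c=\sum_{a\in A(c)}\omega_a\tau_a$. **cXPESP.** Minimize $\sum_{c\in C}\vartheta_cx_c+\sum_{a\in Z(D)}\omega_a\tau_az_a$ over $x\in\mathbb Z_{\ge0}^C$, $z\in\mathbb Z_{\ge0}^{Z(D)}$ subject to $\sum_{c\in C_L}x_c=1$ for all $L\in\mathcal L$, and for all $\alpha=(v,w)\in Z(N)$, $t\in[T]$: $\sum_{c\in C: v[t]\in c}x_c=\sum_{a\in\delta^+_{\mathcal A(\alpha)}(v[t])}z_a$ and $\sum_{c\in C: w[t]\in c}x_c=\sum_{a\in\delta^-_{\mathcal A(\alpha)}(w[t])}z_a$. The linear programming relaxation allows $x,z$ to be nonnegative rational. The problem restricted to a single line $L$ is cXPESP for the network consisting of the line cycle of $L$ only: minimize $\sum_{c\in C_L}\vartheta_cx_c$ subject to $\sum_{c\in C_L}x_c=1$, $x_c\in\mathbb Z_{\ge0}$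 (nonnegative rational in its linear programming relaxation).
   Formalization: Both lower bounds with Σ ω_α l_α are proved for ω_α ≥ 0 on transfer activities (false for negative ones, e.g. l=0, u=1, T=2, ω=-1); "does not have to include" means some LP optimum restricted to a line is not an optimal solution of that line's integer program. *)

theory Defs
  imports "Graph_Theory.Graph_Theory" "HOL-Library.Extended_Real"
begin

section \<open>Line networks and event-activity networks\<close>

datatype kind = Dep | Arr

datatype direction = Plus | Minus

text \<open>A line is the list of its stops; an event (v, L, k, s) is the departure or arrival of
  line L at stop v in direction s.\<close>

type_synonym 'v line = "'v list"
type_synonym 'v event = "'v \<times> 'v line \<times> kind \<times> direction"
type_synonym 'v activity = "'v event \<times> 'v event"

text \<open>An undirected graph is a symmetric digraph, as usual in the graph library; \<open>vpath\<close> is the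
  library's notion of a (vertex-simple) path. Loops are admitted but no path can use them.\<close>

definition line_network :: "'v pair_pre_digraph \<Rightarrow> 'v line set \<Rightarrow> bool" where
  "line_network G \<L> \<longleftrightarrow> pair_pseudo_graph G \<and> finite \<L> \<and>
     (\<forall>L\<in>\<L>. vpath L (with_proj G) \<and> 2 \<le> length L)"

definition line_events :: "'v line \<Rightarrow> 'v event set" where
  "line_events L = (\<Union>i\<in>{i. Suc i < length L}.
     {(L ! i, L, Dep, Plus), (L ! Suc i, L, Arr, Plus),
      (L ! Suc i, L, Dep, Minus), (L ! i, L, Arr, Minus)})"

definition driving :: "'v line \<Rightarrow> 'v activity set" where
  "driving L = (\<Union>i\<in>{i. Suc i < length L}.
     {((L ! i, L, Dep, Plus), (L ! Suc i, L, Arr, Plus)),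
      ((L ! Suc i, L, Dep, Minus), (L ! i, L, Arr, Minus))})"

definition waiting :: "'v line \<Rightarrow> 'v activity set" where
  "waiting L = {((v, L, Arr, s), (v, L, Dep, s)) | v s.
     v \<in> set L \<and> (v, L, Arr, s) \<in> line_events L \<and> (v, L, Dep, s) \<in> line_events L}"

definition turnaround :: "'v line \<Rightarrow> 'v activity set" where
  "turnaround L = {((hd L, L, Arr, Minus), (hd L, L, Dep, Plus)),
                   ((last L, L, Arr, Plus), (last L, L, Dep, Minus))}"

definition transfers :: "'v line set \<Rightarrow> 'v activity set" where
  "transfers \<L> = {((v, L, Arr, s\<^sub>1), (v, L', Dep, s\<^sub>2)) | v L L' s\<^sub>1 s\<^sub>2.
     L \<in> \<L> \<and> L' \<in> \<L> \<and> L \<noteq> L' \<and> v \<in> set L \<and> v \<in> set L' \<and>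
     (v, L, Arr, s\<^sub>1) \<in> line_events L \<and> (v, L', Dep, s\<^sub>2) \<in> line_events L'}"

definition line_cycle :: "'v line \<Rightarrow> 'v event pair_pre_digraph" where
  "line_cycle L = \<lparr> pverts = line_events L, parcs = driving L \<union> waiting L \<union> turnaround L \<rparr>"

definition event_activity_network :: "'v line set \<Rightarrow> 'v event pair_pre_digraph" where
  "event_activity_network \<L> =
     \<lparr> pverts = (\<Union>L\<in>\<L>. pverts (line_cycle L)),
       parcs = (\<Union>L\<in>\<L>. parcs (line_cycle L)) \<union> transfers \<L> \<rparr>"

section \<open>Instances and the expanded network\<close>

text \<open>The functions \<open>lower\<close>, \<open>upper\<close> and \<open>weight\<close> (l, u and \<open>\<omega>\<close>) matter only on the
  activities of the network.\<close>

record 'v pesp =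
  graph :: "'v pair_pre_digraph"
  lines :: "'v line set"
  period :: nat
  lower :: "'v activity \<Rightarrow> int"
  upper :: "'v activity \<Rightarrow> int"
  weight :: "'v activity \<Rightarrow> rat"

abbreviation network :: "'v pesp \<Rightarrow> 'v event pair_pre_digraph" where
  "network I \<equiv> event_activity_network (lines I)"

abbreviation transfer_acts :: "'v pesp \<Rightarrow> 'v activity set" where
  "transfer_acts I \<equiv> transfers (lines I)"

definition pesp_instance :: "'v pesp \<Rightarrow> bool" where
  "pesp_instance I \<longleftrightarrow> line_network (graph I) (lines I) \<and> 1 \<le> period I \<and>
     (\<forall>\<alpha>\<in>parcs (network I). lower I \<alpha> \<le> upper I \<alpha>)"

text \<open>The pair (v, t) is the expanded node v[t].\<close>

type_synonym 'v node = "'v event \<times> nat"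
type_synonym 'v arc = "'v node \<times> 'v node"

definition arc_copies :: "'v pesp \<Rightarrow> 'v activity \<Rightarrow> 'v arc set" where
  "arc_copies I \<alpha> = {((fst \<alpha>, t), (snd \<alpha>, t')) | t t'. t < period I \<and> t' < period I \<and>
     (int t' - int t - lower I \<alpha>) mod int (period I) \<le> upper I \<alpha> - lower I \<alpha>}"

definition expanded_network :: "'v pesp \<Rightarrow> 'v node pair_pre_digraph" where
  "expanded_network I =
     \<lparr> pverts = pverts (network I) \<times> {..<period I},
       parcs = (\<Union>\<alpha>\<in>parcs (network I). arc_copies I \<alpha>) \<rparr>"

definition transfer_arcs :: "'v pesp \<Rightarrow> 'v arc set" where
  "transfer_arcs I = (\<Union>\<alpha>\<in>transfer_acts I. arc_copies I \<alpha>)"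

text \<open>The network has no parallel arcs, so an expanded arc determines its activity.\<close>

definition arc_activity :: "'v arc \<Rightarrow> 'v activity" where
  "arc_activity a = (fst (fst a), fst (snd a))"

definition arc_duration :: "'v pesp \<Rightarrow> 'v arc \<Rightarrow> int" where
  "arc_duration I a =
     (int (snd (snd a)) - int (snd (fst a)) - lower I (arc_activity a)) mod int (period I)
       + lower I (arc_activity a)"

definition arc_weight :: "'v pesp \<Rightarrow> 'v arc \<Rightarrow> rat" where
  "arc_weight I a = weight I (arc_activity a)"

definition arc_cost :: "'v pesp \<Rightarrow> 'v arc \<Rightarrow> rat" where
  "arc_cost I a = arc_weight I a * of_int (arc_duration I a)"

definition out_arcs_in :: "'v arc set \<Rightarrow> 'v node \<Rightarrow> 'v arc set" where
  "out_arcs_in S n = {a \<in> S. fst a = n}"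

definition in_arcs_in :: "'v arc set \<Rightarrow> 'v node \<Rightarrow> 'v arc set" where
  "in_arcs_in S n = {a \<in> S. snd a = n}"

section \<open>Cycles of a line\<close>

definition expanded_line_cycle :: "'v pesp \<Rightarrow> 'v line \<Rightarrow> ('v node, 'v arc) pre_digraph" where
  "expanded_line_cycle I L =
     with_proj (expanded_network I) \<restriction> (pverts (line_cycle L) \<times> {..<period I})"

text \<open>A cycle is identified with its set of arcs, since the library's \<open>cycle\<close> is an arc list and
  hence fixes a starting point; on such an arc set the tails are exactly the nodes visited.\<close>

definition cycle_nodes :: "'v arc set \<Rightarrow> 'v node set" where
  "cycle_nodes c = fst ` c"

definition line_cycles :: "'v pesp \<Rightarrow> 'v line \<Rightarrow> 'v arc set set" where
  "line_cycles I L = {set p | p. pre_digraph.cycle (expanded_line_cycle I L) p \<and>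
     card (cycle_nodes (set p)) = card (pverts (line_cycle L))}"

definition all_cycles :: "'v pesp \<Rightarrow> 'v arc set set" where
  "all_cycles I = (\<Union>L\<in>lines I. line_cycles I L)"

definition cycle_cost :: "'v pesp \<Rightarrow> 'v arc set \<Rightarrow> rat" where
  "cycle_cost I c = (\<Sum>a\<in>c. arc_cost I a)"

section \<open>cXPESP, its relaxation, and the single-line problems\<close>

text \<open>The parameter K is the set of admissible variable values: \<open>\<nat>\<close> for the integer program,
  the nonnegative rationals for its linear programming relaxation. Only the values of x on cycles
  and of z on expanded transfer arcs matter.\<close>

definition nonneg_rats :: "rat set" where
  "nonneg_rats = {0..}"

definition feasible :: "rat set \<Rightarrow> 'v pesp \<Rightarrow> ('v arc set \<Rightarrow> rat) \<Rightarrow> ('v arc \<Rightarrow> rat) \<Rightarrow> bool" where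
  "feasible K I x z \<longleftrightarrow>
     (\<forall>c\<in>all_cycles I. x c \<in> K) \<and> (\<forall>a\<in>transfer_arcs I. z a \<in> K) \<and>
     (\<forall>L\<in>lines I. (\<Sum>c\<in>line_cycles I L. x c) = 1) \<and>
     (\<forall>(v, w)\<in>transfer_acts I. \<forall>t<period I.
        (\<Sum>c\<in>{c \<in> all_cycles I. (v, t) \<in> cycle_nodes c}. x c) =
          (\<Sum>a\<in>out_arcs_in (arc_copies I (v, w)) (v, t). z a) \<and>
        (\<Sum>c\<in>{c \<in> all_cycles I. (w, t) \<in> cycle_nodes c}. x c) =
          (\<Sum>a\<in>in_arcs_in (arc_copies I (v, w)) (w, t). z a))"

definition objective :: "'v pesp \<Rightarrow> ('v arc set \<Rightarrow> rat) \<Rightarrow> ('v arc \<Rightarrow> rat) \<Rightarrow> rat" where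
  "objective I x z =
     (\<Sum>c\<in>all_cycles I. cycle_cost I c * x c) + (\<Sum>a\<in>transfer_arcs I. arc_cost I a * z a)"

definition optimal :: "rat set \<Rightarrow> 'v pesp \<Rightarrow> ('v arc set \<Rightarrow> rat) \<Rightarrow> ('v arc \<Rightarrow> rat) \<Rightarrow> bool" where
  "optimal K I x z \<longleftrightarrow> feasible K I x z \<and>
     (\<forall>x' z'. feasible K I x' z' \<longrightarrow> objective I x z \<le> objective I x' z')"

text \<open>Optimal values are infima in the extended reals; in particular an infeasible problem
  has optimal value \<open>\<infinity>\<close>.\<close>

definition optimal_value :: "rat set \<Rightarrow> 'v pesp \<Rightarrow> ereal" where
  "optimal_value K I =
     Inf {ereal (real_of_rat (objective I x z)) | x z. feasible K I x z}"

definition line_feasible :: "rat set \<Rightarrow> 'v pesp \<Rightarrow> 'v line \<Rightarrow> ('v arc set \<Rightarrow> rat) \<Rightarrow> bool" where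
  "line_feasible K I L x \<longleftrightarrow>
     (\<forall>c\<in>line_cycles I L. x c \<in> K) \<and> (\<Sum>c\<in>line_cycles I L. x c) = 1"

definition line_objective :: "'v pesp \<Rightarrow> 'v line \<Rightarrow> ('v arc set \<Rightarrow> rat) \<Rightarrow> rat" where
  "line_objective I L x = (\<Sum>c\<in>line_cycles I L. cycle_cost I c * x c)"

definition line_optimal :: "rat set \<Rightarrow> 'v pesp \<Rightarrow> 'v line \<Rightarrow> ('v arc set \<Rightarrow> rat) \<Rightarrow> bool" where
  "line_optimal K I L x \<longleftrightarrow> line_feasible K I L x \<and>
     (\<forall>x'. line_feasible K I L x' \<longrightarrow> line_objective I L x \<le> line_objective I L x')"

definition line_optimal_value :: "rat set \<Rightarrow> 'v pesp \<Rightarrow> 'v line \<Rightarrow> ereal" where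
  "line_optimal_value K I L =
     Inf {ereal (real_of_rat (line_objective I L x)) | x. line_feasible K I L x}"

abbreviation "optimal_value_IP \<equiv> optimal_value \<nat>"
abbreviation "optimal_value_LP \<equiv> optimal_value nonneg_rats"
abbreviation "line_optimal_value_IP \<equiv> line_optimal_value \<nat>"
abbreviation "line_optimal_value_LP \<equiv> line_optimal_value nonneg_rats"
abbreviation "optimal_LP \<equiv> optimal nonneg_rats"
abbreviation "line_optimal_IP \<equiv> line_optimal \<nat>"

definition transfer_bound :: "'v pesp \<Rightarrow> rat" where
  "transfer_bound I = (\<Sum>\<alpha>\<in>transfer_acts I. weight I \<alpha> * of_int (lower I \<alpha>))"

definition nonneg_transfer_weights :: "'v pesp \<Rightarrow> bool" where
  "nonneg_transfer_weights I \<longleftrightarrow> (\<forall>\<alpha>\<in>transfer_acts I. 0 \<le> weight I \<alpha>)"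

end

theory Submission
  imports Defs
begin

text \<open>A cycle of a line visits every event at exactly one time. Hence in a feasible solution the
  flow through all copies of an event is 1, so the copies of each transfer activity carry total
  flow 1, each unit at duration at least the lower bound.\<close>

section \<open>Cycles in digraphs\<close>

text \<open>Each inner node of a walk is the head of one arc and the tail of the next, so only the
  end nodes differ. On a closed walk the tails and heads thus agree with multiplicity.\<close>

lemma (in pre_digraph) cas_mset_tails_heads:
  "cas u p v \<Longrightarrow> add_mset v (mset (map (tail G) p)) = add_mset u (mset (map (head G) p))"
  by (induction p arbitrary: u) (auto simp: add_mset_commute)

lemma (in pre_digraph) cycle_arcs:
  assumes "cycle p"
  shows "set p \<subseteq> arcs G" "inj_on (tail G) (set p)" "inj_on (head G) (set p)"
    "tail G ` set p = head G ` set p"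
proof -
  obtain u where u: "awalk u p u" "distinct (tl (awalk_verts u p))"
    using assms by (auto simp: cycle_def)
  then show "set p \<subseteq> arcs G"
    by (simp add: awalk_def)
  have cas: "cas u p u"
    using u by (simp add: awalk_def)
  then have ms: "mset (map (tail G) p) = mset (map (head G) p)"
    using cas_mset_tails_heads by fastforce
  \<comment> \<open>On a non-empty walk \<open>awalk_verts\<close> is the first tail followed by all
    heads, so \<open>cycle\<close> speaks about heads; the multiset equality carries distinctness
    over to tails.\<close>
  have "distinct (map (head G) p)"
    using u(2) unfolding awalk_verts_conv'[OF cas] by (cases p) simp_all
  moreover from this have "distinct (map (tail G) p)"
    using ms mset_eq_imp_distinct_iff by blast
  ultimately show "inj_on (tail G) (set p)" "inj_on (head G) (set p)"
    by (simp_all add: distinct_map)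
  show "tail G ` set p = head G ` set p"
    using mset_eq_setD[OF ms] by simp
qed

section \<open>The line cycle\<close>

lemma finite_line_events: "finite (line_events L)"
proof -
  have "finite {i. Suc i < length L}"
    by (rule finite_subset[of _ "{..<length L}"]) auto
  then show ?thesis
    by (simp add: line_events_def)
qed

lemma line_events_line: "e \<in> line_events L \<Longrightarrow> fst (snd e) = L"
  by (auto simp: line_events_def)

lemma line_events_nonempty: "2 \<le> length L \<Longrightarrow> line_events L \<noteq> {}"
  by (auto simp: line_events_def intro!: exI[of _ 0])

lemma line_cycle_arc_line:
  "(e, f) \<in> parcs (line_cycle L) \<Longrightarrow> fst (snd e) = L \<and> fst (snd f) = L"
  by (auto simp: line_cycle_def driving_def waiting_def turnaround_def)

text \<open>At a terminal stop these missing events rule out waiting, so the turnaround there has no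
  competitor. The uniqueness of successors and predecessors rests on this.\<close>

lemma terminal_events:
  assumes "distinct L" "2 \<le> length L"
  shows "(hd L, L, Dep, Minus) \<notin> line_events L" "(hd L, L, Arr, Plus) \<notin> line_events L"
    "(last L, L, Dep, Plus) \<notin> line_events L" "(last L, L, Arr, Minus) \<notin> line_events L"
proof -
  have "L \<noteq> []"
    using assms(2) by auto
  then show "(hd L, L, Dep, Minus) \<notin> line_events L" "(hd L, L, Arr, Plus) \<notin> line_events L"
    "(last L, L, Dep, Plus) \<notin> line_events L" "(last L, L, Arr, Minus) \<notin> line_events L"
    using assms(1) by (auto simp: line_events_def hd_conv_nth last_conv_nth nth_eq_iff_index_eq)
qed

lemma line_cycle_right_unique:
  assumes "distinct L" "2 \<le> length L"
    and "(e, f) \<in> parcs (line_cycle L)" "(e, f') \<in> parcs (line_cycle L)"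
  shows "f = f'"
  using assms(3,4) terminal_events[OF assms(1,2)] assms(1)
  by (auto simp: line_cycle_def driving_def waiting_def turnaround_def nth_eq_iff_index_eq)

lemma line_cycle_left_unique:
  assumes "distinct L" "2 \<le> length L"
    and "(e, f) \<in> parcs (line_cycle L)" "(e', f) \<in> parcs (line_cycle L)"
  shows "e = e'"
  using assms(3,4) terminal_events[OF assms(1,2)] assms(1)
  by (auto simp: line_cycle_def driving_def waiting_def turnaround_def nth_eq_iff_index_eq)

text \<open>Connectivity of the line cycle, phrased for functions instead of walks so that it
  applies directly to visit counts. The proof goes out in direction \<open>Plus\<close>, turns at
  the last stop and comes back.\<close>

lemma line_cycle_invariant_constant:
  assumes len: "2 \<le> length L"
    and inv: "\<And>e f. (e, f) \<in> parcs (line_cycle L) \<Longrightarrow> g e = g f"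
    and e: "e \<in> line_events L"
  shows "g e = g (hd L, L, Dep, Plus)"
proof -
  let ?k = "g (hd L, L, Dep, Plus)"
  have ne: "L \<noteq> []"
    using len by auto
  have drive: "g (L ! i, L, Dep, Plus) = g (L ! Suc i, L, Arr, Plus)"
    "g (L ! Suc i, L, Dep, Minus) = g (L ! i, L, Arr, Minus)" if "Suc i < length L" for i
    using that by (auto intro!: inv simp: line_cycle_def driving_def)
  have wait: "g (L ! Suc i, L, Arr, Plus) = g (L ! Suc i, L, Dep, Plus)"
    "g (L ! Suc i, L, Arr, Minus) = g (L ! Suc i, L, Dep, Minus)" if "Suc (Suc i) < length L" for i
  proof -
    \<comment> \<open>At an inner stop the four events come from two edges: the one before it
      supplies these two, the one after it the other two.\<close>
    have "(L ! Suc i, L, Arr, Plus) \<in> line_events L" "(L ! Suc i, L, Dep, Minus) \<in> line_events L"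
      using that unfolding line_events_def by (auto intro!: exI[of _ i])
    moreover have "(L ! Suc i, L, Dep, Plus) \<in> line_events L" "(L ! Suc i, L, Arr, Minus) \<in> line_events L"
      using that unfolding line_events_def by (auto intro!: exI[of _ "Suc i"])
    ultimately show "g (L ! Suc i, L, Arr, Plus) = g (L ! Suc i, L, Dep, Plus)"
      "g (L ! Suc i, L, Arr, Minus) = g (L ! Suc i, L, Dep, Minus)"
      using that by (auto intro!: inv simp: line_cycle_def waiting_def)
  qed
  have plus: "g (L ! i, L, Dep, Plus) = ?k" if "Suc i < length L" for i
    using that
  proof (induction i)
    case 0
    then show ?case
      using ne by (simp add: hd_conv_nth)
  next
    case (Suc i)
    then show ?case
      using drive(1)[of i] wait(1)[of i] by simp
  qed
  have turn: "g (last L, L, Arr, Plus) = g (last L, L, Dep, Minus)"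
    by (auto intro!: inv simp: line_cycle_def turnaround_def)
  \<comment> \<open>Here \<open>j\<close> is the number of edges left to the last stop; the return
    trip is an induction on it, starting from the turnaround.\<close>
  have minus: "g (L ! Suc i, L, Dep, Minus) = ?k" if "Suc i + j = length L - 1" for i j
    using that
  proof (induction j arbitrary: i)
    case 0
    then have "last L = L ! Suc i"
      using ne by (simp add: last_conv_nth)
    then show ?case
      using 0 turn drive(1)[of i] plus[of i] ne len by (cases "length L") auto
  next
    case (Suc j)
    then show ?case
      using Suc.IH[of "Suc i"] drive(2)[of "Suc i"] wait(2)[of i] by simp
  qed
  have "g (L ! Suc i, L, Dep, Minus) = ?k" if "Suc i < length L" for i
    using minus[of i "length L - 1 - Suc i"] that by simp
  then show ?thesis
    using e drive plus by (auto simp: line_events_def)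
qed

section \<open>Cycles of a line\<close>

text \<open>The expanded line cycle is an induced subgraph. It picks up no foreign arcs, because
  events carry their line and transfers join different lines.\<close>

lemma network_arc_within_line:
  assumes "(e, f) \<in> parcs (network I)" "e \<in> line_events L" "f \<in> line_events L"
  shows "(e, f) \<in> parcs (line_cycle L)"
proof -
  have L: "fst (snd e) = L" "fst (snd f) = L"
    using assms(2,3) by (simp_all add: line_events_line)
  then have "(e, f) \<notin> transfers (lines I)"
    by (auto simp: transfers_def)
  then obtain L' where "(e, f) \<in> parcs (line_cycle L')"
    using assms(1) by (auto simp: event_activity_network_def)
  then show ?thesis
    using line_cycle_arc_line L by blast
qed

text \<open>Trades the arc list of a cycle for properties of its arc set; the lower bound argument
  never returns to the list.\<close>

lemma line_cycle_arcs:
  assumes "c \<in> line_cycles I L"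
  shows "inj_on fst c" "inj_on snd c" "fst ` c = snd ` c" "finite c"
    "card c = card (line_events L)"
    "a \<in> c \<Longrightarrow> arc_activity a \<in> parcs (line_cycle L) \<and> fst (fst a) \<in> line_events L
      \<and> snd (fst a) < period I \<and> snd (snd a) < period I"
proof -
  obtain p where p: "c = set p" "pre_digraph.cycle (expanded_line_cycle I L) p"
    "card (cycle_nodes (set p)) = card (pverts (line_cycle L))"
    using assms by (auto simp: line_cycles_def)
  note props = pre_digraph.cycle_arcs[OF p(2)]
  show inj: "inj_on fst c" and "inj_on snd c" "fst ` c = snd ` c" "finite c"
    using props by (simp_all add: p(1) expanded_line_cycle_def)
  show "card c = card (line_events L)"
    using p(3) card_image[OF inj] by (simp add: p(1) cycle_nodes_def line_cycle_def)
  assume "a \<in> c"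
  then have "a \<in> parcs (expanded_network I)" "fst a \<in> line_events L \<times> {..<period I}"
    "snd a \<in> line_events L \<times> {..<period I}"
    using props(1) by (auto simp: p(1) expanded_line_cycle_def line_cycle_def)
  moreover from this have "arc_activity a \<in> parcs (network I)"
    by (auto simp: expanded_network_def arc_copies_def arc_activity_def)
  ultimately show "arc_activity a \<in> parcs (line_cycle L) \<and> fst (fst a) \<in> line_events L
      \<and> snd (fst a) < period I \<and> snd (snd a) < period I"
    by (auto simp: arc_activity_def mem_Times_iff intro!: network_arc_within_line)
qed

lemma cycle_nodes_line:
  "c \<in> line_cycles I L \<Longrightarrow> (e, t) \<in> cycle_nodes c \<Longrightarrow> e \<in> line_events L \<and> t < period I"
  using line_cycle_arcs(6) by (force simp: cycle_nodes_def)

lemma line_cycle_nonempty: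
  "2 \<le> length L \<Longrightarrow> c \<in> line_cycles I L \<Longrightarrow> c \<noteq> {}"
  using line_cycle_arcs(5) line_events_nonempty[of L] finite_line_events[of L] by fastforce

text \<open>The number of visits is constant along the line cycle, since every event has a unique
  successor and a unique predecessor there; as a cycle visits as many nodes as there are events,
  this constant is 1.\<close>

lemma line_cycle_visits_once:
  assumes L: "distinct L" "2 \<le> length L"
    and c: "c \<in> line_cycles I L" and e: "e \<in> line_events L"
  shows "card {t. t < period I \<and> (e, t) \<in> cycle_nodes c} = 1"
proof -
  note props = line_cycle_arcs[OF c]
  define g where "g e = card {a \<in> c. fst (fst a) = e}" for e
  \<comment> \<open>An arc of \<open>c\<close> is determined by its tail and also by its head, and
    both range over the same nodes. Visits to \<open>e\<close> can therefore be counted by leaving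
    or by entering arcs.\<close>
  have tails: "g e = card {n \<in> fst ` c. fst n = e}" for e
  proof -
    have "{n \<in> fst ` c. fst n = e} = fst ` {a \<in> c. fst (fst a) = e}"
      by auto
    then show ?thesis
      unfolding g_def using props(1) by (simp add: card_image inj_on_subset)
  qed
  have heads: "g e = card {a \<in> c. fst (snd a) = e}" for e
  proof -
    have "{n \<in> snd ` c. fst n = e} = snd ` {a \<in> c. fst (snd a) = e}"
      by auto
    then show ?thesis
      unfolding tails props(3) using props(2) by (simp add: card_image inj_on_subset)
  qed
  have inv: "g e = g f" if ef: "(e, f) \<in> parcs (line_cycle L)" for e f
  proof -
    \<comment> \<open>Hence the arcs leaving copies of \<open>e\<close> are the very arcs entering
      copies of \<open>f\<close>.\<close>
    have "fst (fst a) = e \<longleftrightarrow> fst (snd a) = f" if a: "a \<in> c" for a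
      using props(6)[OF a] ef line_cycle_right_unique[OF L] line_cycle_left_unique[OF L]
      unfolding arc_activity_def by metis
    then show ?thesis
      unfolding heads[of f] unfolding g_def by (metis (no_types, lifting))
  qed
  define k where "k = g (hd L, L, Dep, Plus)"
  have const: "g e = k" if "e \<in> line_events L" for e
    using line_cycle_invariant_constant[OF L(2) inv that] by (simp add: k_def)
  \<comment> \<open>Double counting: sorting the arcs by tail event gives \<open>card c\<close> as
    the number of events times \<open>k\<close>, while \<open>card c\<close> equals the number of
    events.\<close>
  have "card c = (\<Sum>e\<in>line_events L. g e)"
    unfolding g_def
    using sum.group[OF props(4) finite_line_events, of "\<lambda>a. fst (fst a)" L "\<lambda>_. 1 :: nat"] props(6)
    by (simp add: image_subset_iff)
  also have "\<dots> = card (line_events L) * k"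
    by (simp add: const)
  finally have "k = 1"
    using props(5) line_events_nonempty[OF L(2)] finite_line_events[of L] by simp
  moreover have "{n \<in> fst ` c. fst n = e} = Pair e ` {t. t < period I \<and> (e, t) \<in> cycle_nodes c}"
    unfolding cycle_nodes_def[symmetric]
  proof (intro set_eqI iffI)
    fix n assume "n \<in> {n \<in> cycle_nodes c. fst n = e}"
    then have "n = (e, snd n)" "(e, snd n) \<in> cycle_nodes c"
      by auto
    then show "n \<in> Pair e ` {t. t < period I \<and> (e, t) \<in> cycle_nodes c}"
      using cycle_nodes_line[OF c] by blast
  qed auto
  then have "g e = card {t. t < period I \<and> (e, t) \<in> cycle_nodes c}"
    unfolding tails by (simp add: card_image inj_on_def)
  ultimately show ?thesis
    using const[OF e] by simp
qed

section \<open>Finiteness and disjointness\<close>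

lemma finite_arc_copies: "finite (arc_copies I \<alpha>)"
proof (rule finite_subset)
  show "arc_copies I \<alpha> \<subseteq> ({fst \<alpha>} \<times> {..<period I}) \<times> ({snd \<alpha>} \<times> {..<period I})"
    by (auto simp: arc_copies_def)
qed simp

lemma arc_copies_activity: "a \<in> arc_copies I \<alpha> \<Longrightarrow> arc_activity a = \<alpha>"
  by (auto simp: arc_copies_def arc_activity_def)

lemma finite_line_cycles: "finite (line_cycles I L)"
proof (rule finite_subset)
  let ?V = "line_events L \<times> {..<period I}"
  show "line_cycles I L \<subseteq> Pow (?V \<times> ?V)"
  proof (intro subsetI PowI)
    fix c a assume c: "c \<in> line_cycles I L" "a \<in> c"
    then have "fst a \<in> cycle_nodes c" "snd a \<in> cycle_nodes c"
      using line_cycle_arcs(3)[OF c(1)] by (auto simp: cycle_nodes_def)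
    moreover have "cycle_nodes c \<subseteq> ?V"
      using cycle_nodes_line[OF c(1)] by auto
    ultimately show "a \<in> ?V \<times> ?V"
      by (auto simp: mem_Times_iff)
  qed
qed (simp add: finite_line_events)

lemma finite_transfers: "finite \<L> \<Longrightarrow> finite (transfers \<L>)"
proof (rule finite_subset)
  show "transfers \<L> \<subseteq> (\<Union>L\<in>\<L>. line_events L) \<times> (\<Union>L\<in>\<L>. line_events L)"
    by (auto simp: transfers_def)
qed (simp add: finite_line_events)

lemma pesp_instance_lines:
  assumes "pesp_instance I"
  shows "finite (lines I)" "L \<in> lines I \<Longrightarrow> distinct L" "L \<in> lines I \<Longrightarrow> 2 \<le> length L"
  using assms by (auto simp: pesp_instance_def line_network_def vpath_def)

text \<open>A common cycle has an arc, and the tail event of that arc would name both lines.\<close>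

lemma line_cycles_disjoint:
  assumes "2 \<le> length L" "L \<noteq> L'"
  shows "line_cycles I L \<inter> line_cycles I L' = {}"
proof (rule ccontr)
  assume "line_cycles I L \<inter> line_cycles I L' \<noteq> {}"
  then obtain c where c: "c \<in> line_cycles I L" "c \<in> line_cycles I L'"
    by blast
  then obtain a where "a \<in> c"
    using line_cycle_nonempty[OF assms(1)] by blast
  then show False
    using line_cycle_arcs(6)[OF c(1)] line_cycle_arcs(6)[OF c(2)] line_events_line assms(2)
    by metis
qed

section \<open>Regrouping sums by lines and by transfer activities\<close>

lemma sum_all_cycles:
  assumes "pesp_instance I"
  shows "(\<Sum>c\<in>all_cycles I. h c) = (\<Sum>L\<in>lines I. \<Sum>c\<in>line_cycles I L. h c)"
  unfolding all_cycles_def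
  by (intro sum.UNION_disjoint)
    (use pesp_instance_lines[OF assms] line_cycles_disjoint in \<open>blast intro: finite_line_cycles\<close>)+

lemma sum_transfer_arcs:
  assumes "finite (lines I)"
  shows "(\<Sum>a\<in>transfer_arcs I. h a) = (\<Sum>\<alpha>\<in>transfer_acts I. \<Sum>a\<in>arc_copies I \<alpha>. h a)"
  unfolding transfer_arcs_def
proof (rule sum.UNION_disjoint[OF finite_transfers[OF assms]])
  show "\<forall>\<alpha>\<in>transfer_acts I. \<forall>\<beta>\<in>transfer_acts I. \<alpha> \<noteq> \<beta> \<longrightarrow> arc_copies I \<alpha> \<inter> arc_copies I \<beta> = {}"
    using arc_copies_activity by blast
qed (simp add: finite_arc_copies)

section \<open>The lower bound\<close>

text \<open>Events name their line, so the coupling constraints at a node involve the variables of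
  one line only.\<close>

lemma cycles_through_node:
  assumes "L \<in> lines I" "e \<in> line_events L"
  shows "{c \<in> all_cycles I. (e, t) \<in> cycle_nodes c} = {c \<in> line_cycles I L. (e, t) \<in> cycle_nodes c}"
proof -
  have "c \<in> line_cycles I L" if "c \<in> line_cycles I L'" "(e, t) \<in> cycle_nodes c" for c L'
    using cycle_nodes_line[OF that] that(1) line_events_line assms(2) by metis
  then show ?thesis
    using assms(1) by (auto simp: all_cycles_def)
qed

text \<open>After exchanging the sums, each cycle of \<open>L\<close> is counted once for every time
  at which it visits \<open>e\<close>, which is exactly once.\<close>

lemma event_total_flow:
  assumes I: "pesp_instance I" and L: "L \<in> lines I" and e: "e \<in> line_events L"
    and x: "(\<Sum>c\<in>line_cycles I L. x c) = (1 :: rat)"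
  shows "(\<Sum>t<period I. \<Sum>c\<in>{c \<in> all_cycles I. (e, t) \<in> cycle_nodes c}. x c) = 1"
proof -
  let ?C = "line_cycles I L"
  have "(\<Sum>t<period I. \<Sum>c\<in>{c \<in> all_cycles I. (e, t) \<in> cycle_nodes c}. x c)
      = (\<Sum>t<period I. \<Sum>c\<in>?C. if (e, t) \<in> cycle_nodes c then x c else 0)"
    unfolding cycles_through_node[OF L e] by (simp add: sum.inter_filter finite_line_cycles)
  also have "\<dots> = (\<Sum>c\<in>?C. \<Sum>t<period I. if (e, t) \<in> cycle_nodes c then x c else 0)"
    by (rule sum.swap)
  also have "\<dots> = (\<Sum>c\<in>?C. x c)"
  proof (rule sum.cong[OF refl])
    fix c assume c: "c \<in> ?C"
    have "(\<Sum>t<period I. if (e, t) \<in> cycle_nodes c then x c else 0)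
        = of_nat (card {t \<in> {..<period I}. (e, t) \<in> cycle_nodes c}) * x c"
      by (simp flip: sum.inter_filter)
    also have "{t \<in> {..<period I}. (e, t) \<in> cycle_nodes c} = {t. t < period I \<and> (e, t) \<in> cycle_nodes c}"
      by auto
    finally show "(\<Sum>t<period I. if (e, t) \<in> cycle_nodes c then x c else 0) = x c"
      using line_cycle_visits_once[OF pesp_instance_lines(2)[OF I L] pesp_instance_lines(3)[OF I L] c e] by simp
  qed
  finally show ?thesis
    using x by simp
qed

text \<open>Sorting the copies of the transfer by departure time makes the outflow constraints at
  its tail event applicable; the total is then the flow through that event.\<close>

lemma transfer_total_flow:
  assumes I: "pesp_instance I" and feas: "feasible K I x z" and \<alpha>: "\<alpha> \<in> transfer_acts I"
  shows "(\<Sum>a\<in>arc_copies I \<alpha>. z a) = 1"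
proof -
  obtain v w where vw: "\<alpha> = (v, w)"
    by (cases \<alpha>)
  obtain L where L: "L \<in> lines I" "v \<in> line_events L"
    using \<alpha> by (auto simp: vw transfers_def)
  have "(\<Sum>a\<in>arc_copies I \<alpha>. z a)
      = (\<Sum>t<period I. \<Sum>a\<in>{a \<in> arc_copies I \<alpha>. snd (fst a) = t}. z a)"
    by (rule sum.group[symmetric]) (auto simp: finite_arc_copies, auto simp: arc_copies_def)
  also have "\<dots> = (\<Sum>t<period I. \<Sum>a\<in>out_arcs_in (arc_copies I (v, w)) (v, t). z a)"
    by (intro sum.cong) (auto simp: vw out_arcs_in_def arc_copies_def)
  also have "\<dots> = (\<Sum>t<period I. \<Sum>c\<in>{c \<in> all_cycles I. (v, t) \<in> cycle_nodes c}. x c)"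
    using feas \<alpha> by (intro sum.cong) (auto simp: vw feasible_def)
  also have "\<dots> = 1"
    using feas L by (intro event_total_flow[OF I L]) (auto simp: feasible_def)
  finally show ?thesis .
qed

lemma lower_le_arc_duration:
  "1 \<le> period I \<Longrightarrow> lower I (arc_activity a) \<le> arc_duration I a"
  by (simp add: arc_duration_def)

text \<open>The copies of a transfer carry one unit of flow at durations no shorter than the lower
  bound. A negative weight would reverse this estimate, hence the sign condition.\<close>

lemma transfer_cost_ge:
  assumes I: "pesp_instance I" and w: "nonneg_transfer_weights I"
    and feas: "feasible nonneg_rats I x z"
  shows "transfer_bound I \<le> (\<Sum>a\<in>transfer_arcs I. arc_cost I a * z a)"
proof -
  have "weight I \<alpha> * of_int (lower I \<alpha>) \<le> (\<Sum>a\<in>arc_copies I \<alpha>. arc_cost I a * z a)"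
    if \<alpha>: "\<alpha> \<in> transfer_acts I" for \<alpha>
  proof -
    \<comment> \<open>Total flow 1 allows the constant to be spread over the copies and compared arc
      by arc.\<close>
    have "weight I \<alpha> * of_int (lower I \<alpha>)
        = (\<Sum>a\<in>arc_copies I \<alpha>. weight I \<alpha> * of_int (lower I \<alpha>) * z a)"
      using transfer_total_flow[OF I feas \<alpha>] by (simp flip: sum_distrib_left)
    also have "\<dots> \<le> (\<Sum>a\<in>arc_copies I \<alpha>. arc_cost I a * z a)"
    proof (rule sum_mono)
      fix a assume a: "a \<in> arc_copies I \<alpha>"
      have "0 \<le> z a"
        using feas \<alpha> a by (auto simp: feasible_def nonneg_rats_def transfer_arcs_def)
      moreover have "0 \<le> weight I \<alpha>"
        using w \<alpha> by (simp add: nonneg_transfer_weights_def)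
      moreover have "of_int (lower I \<alpha>) \<le> (of_int (arc_duration I a) :: rat)"
        using lower_le_arc_duration[of I a] I arc_copies_activity[OF a]
        by (simp add: pesp_instance_def)
      ultimately show "weight I \<alpha> * of_int (lower I \<alpha>) * z a \<le> arc_cost I a * z a"
        using arc_copies_activity[OF a]
        by (simp add: arc_cost_def arc_weight_def mult_left_mono mult_right_mono)
    qed
    finally show ?thesis .
  qed
  then show ?thesis
    unfolding transfer_bound_def sum_transfer_arcs[OF pesp_instance_lines(1)[OF I]]
    by (rule sum_mono)
qed

section \<open>Optimal values\<close>

lemma optimal_value_eq:
  assumes "optimal K I x z"
  shows "optimal_value K I = ereal (real_of_rat (objective I x z))"
  unfolding optimal_value_def
  using assms by (intro antisym Inf_lower Inf_greatest) (auto simp: optimal_def of_rat_less_eq)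

lemma Nats_nonneg_rats: "\<nat> \<subseteq> nonneg_rats"
  by (auto simp: nonneg_rats_def Nats_def)

text \<open>A larger value set admits more feasible points, which can only lower the
  infimum.\<close>

lemma optimal_value_antimono:
  assumes "K \<subseteq> K'"
  shows "optimal_value K' I \<le> optimal_value K I"
  unfolding optimal_value_def feasible_def using assms by (intro Inf_superset_mono) blast

lemma line_optimal_value_antimono:
  assumes "K \<subseteq> K'"
  shows "line_optimal_value K' I L \<le> line_optimal_value K I L"
  unfolding line_optimal_value_def line_feasible_def using assms
  by (intro Inf_superset_mono) blast

text \<open>The feasible set of the relaxation is a simplex, so its minimum is attained at a unit
  vector.\<close>

lemma line_optimal_value_integral:
  "line_optimal_value_LP I L = line_optimal_value_IP I L"
proof (rule antisym[OF line_optimal_value_antimono[OF Nats_nonneg_rats]])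
  let ?C = "line_cycles I L"
  show "line_optimal_value_IP I L \<le> line_optimal_value_LP I L"
    unfolding line_optimal_value_def[of nonneg_rats]
  proof (rule Inf_greatest, clarify)
    fix x assume x: "line_feasible nonneg_rats I L x"
    \<comment> \<open>The empty sum is 0, not 1, so a cycle exists and with it a cheapest one,
      \<open>b\<close>.\<close>
    then have "?C \<noteq> {}"
      by (auto simp: line_feasible_def)
    then obtain b where b: "b \<in> ?C" "\<And>c. c \<in> ?C \<Longrightarrow> cycle_cost I b \<le> cycle_cost I c"
      using finite_line_cycles[of I L] ex_is_arg_min_if_finite[of ?C "cycle_cost I"]
      by (fastforce simp: is_arg_min_linorder)
    define y :: "'a arc set \<Rightarrow> rat" where "y c = of_bool (c = b)" for c
    have "line_feasible \<nat> I L y"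
      using b(1) by (auto simp: line_feasible_def y_def finite_line_cycles)
    moreover have "line_objective I L y = cycle_cost I b"
      using b(1) by (simp add: line_objective_def y_def finite_line_cycles of_bool_def if_distrib cong: if_cong)
    ultimately have "line_optimal_value_IP I L \<le> ereal (real_of_rat (cycle_cost I b))"
      unfolding line_optimal_value_def by (metis (mono_tags, lifting) Inf_lower mem_Collect_eq)
    \<comment> \<open>The values of \<open>x\<close> are convex weights, so their average cost is at
      least the minimum.\<close>
    also have "cycle_cost I b = (\<Sum>c\<in>?C. cycle_cost I b * x c)"
      using x by (simp add: line_feasible_def flip: sum_distrib_left)
    also have "\<dots> \<le> line_objective I L x"
      unfolding line_objective_def using x b(2)
      by (intro sum_mono mult_right_mono) (auto simp: line_feasible_def nonneg_rats_def)
    finally show "line_optimal_value_IP I L \<le> ereal (real_of_rat (line_objective I L x))"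
      by (simp add: of_rat_less_eq)
  qed
qed

text \<open>Stated for every feasible point, so that it serves optimal solutions as well as the
  infimum.\<close>

lemma feasible_objective_ge:
  assumes "pesp_instance I" "nonneg_transfer_weights I" "feasible nonneg_rats I x z"
  shows "(\<Sum>L\<in>lines I. line_objective I L x) + transfer_bound I \<le> objective I x z"
  using transfer_cost_ge[OF assms]
  by (simp add: objective_def line_objective_def sum_all_cycles[OF assms(1)])

text \<open>A feasible \<open>x\<close> is also feasible for each single line, so its share of the
  cost dominates the value of that line. If the relaxation is infeasible, the infimum of the empty
  set is infinite.\<close>

lemma optimal_value_LP_ge:
  assumes "pesp_instance I" "nonneg_transfer_weights I"
  shows "(\<Sum>L\<in>lines I. line_optimal_value_LP I L) + ereal (real_of_rat (transfer_bound I))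
    \<le> optimal_value_LP I"
  unfolding optimal_value_def
proof (rule Inf_greatest, clarify)
  fix x z assume feas: "feasible nonneg_rats I x z"
  have "line_optimal_value_LP I L \<le> ereal (real_of_rat (line_objective I L x))"
    if "L \<in> lines I" for L
    unfolding line_optimal_value_def using feas that
    by (intro Inf_lower) (auto simp: feasible_def line_feasible_def all_cycles_def)
  then have "(\<Sum>L\<in>lines I. line_optimal_value_LP I L) + ereal (real_of_rat (transfer_bound I))
      \<le> (\<Sum>L\<in>lines I. ereal (real_of_rat (line_objective I L x))) + ereal (real_of_rat (transfer_bound I))"
    by (intro add_right_mono sum_mono)
  also have "\<dots> = ereal (real_of_rat ((\<Sum>L\<in>lines I. line_objective I L x) + transfer_bound I))"
    by (simp add: of_rat_add of_rat_sum)
  also have "\<dots> \<le> ereal (real_of_rat (objective I x z))"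
    using feasible_objective_ge[OF assms feas] by (simp add: of_rat_less_eq)
  finally show "(\<Sum>L\<in>lines I. line_optimal_value_LP I L) + ereal (real_of_rat (transfer_bound I))
      \<le> ereal (real_of_rat (objective I x z))" .
qed

section \<open>A fractional optimal solution\<close>

text \<open>All weights are 0, so every feasible solution of the relaxation is optimal; mixing the two
  constant-time cycles with weight 1/2 each is not integral, hence not optimal for the integer
  program of the line.\<close>

definition two_cycle_instance :: "nat pesp" where
  "two_cycle_instance = \<lparr> graph = \<lparr> pverts = {0, 1}, parcs = {(0, 1), (1, 0)} \<rparr>,
     lines = {[0, 1]}, period = 2, lower = \<lambda>_. 0, upper = \<lambda>_. 0, weight = \<lambda>_. 0 \<rparr>"

definition constant_cycle :: "nat \<Rightarrow> nat arc list" where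
  "constant_cycle t =
     (let a = ((0, [0, 1], Dep, Plus), t); b = ((1, [0, 1], Arr, Plus), t);
          c = ((1, [0, 1], Dep, Minus), t); d = ((0, [0, 1], Arr, Minus), t)
      in [(a, b), (b, c), (c, d), (d, a)])"

lemma line_events_one_edge:
  "line_events [u, v] = {(u, [u, v], Dep, Plus), (v, [u, v], Arr, Plus),
     (v, [u, v], Dep, Minus), (u, [u, v], Arr, Minus)}"
proof -
  have "{i. Suc i < length [u, v]} = {0}"
    by auto
  then show ?thesis
    by (auto simp: line_events_def)
qed

text \<open>With a single edge both stops are terminal: the circuit alternates driving and
  turnaround activities.\<close>

lemma line_cycle_one_edge:
  "parcs (line_cycle [u, v]) \<supseteq> {((u, [u, v], Dep, Plus), (v, [u, v], Arr, Plus)),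
     ((v, [u, v], Arr, Plus), (v, [u, v], Dep, Minus)),
     ((v, [u, v], Dep, Minus), (u, [u, v], Arr, Minus)),
     ((u, [u, v], Arr, Minus), (u, [u, v], Dep, Plus))}"
  by (auto simp: line_cycle_def driving_def turnaround_def intro!: exI[of _ 0])

lemma constant_cycle_in_line_cycles:
  assumes "t < 2"
  shows "set (constant_cycle t) \<in> line_cycles two_cycle_instance [0, 1]"
proof -
  let ?D = "expanded_line_cycle two_cycle_instance [0, 1]"
  let ?u = "((0, [0, 1], Dep, Plus), t) :: nat node"
  have sel: "verts ?D = line_events [0, 1] \<times> {..<2}" "tail ?D = fst" "head ?D = snd"
    by (simp_all add: expanded_line_cycle_def line_cycle_def two_cycle_instance_def)
  have D_arc: "((e, t), (f, t)) \<in> arcs ?D"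
    if "(e, f) \<in> parcs (line_cycle [0, 1])" "e \<in> line_events [0, 1]" "f \<in> line_events [0, 1]" for e f
  proof -
    \<comment> \<open>Both bounds are 0, so equal times leave residue 0, within the allowed
      slack.\<close>
    have "((e, t), (f, t)) \<in> arc_copies two_cycle_instance (e, f)"
      using assms by (simp add: arc_copies_def two_cycle_instance_def)
    moreover have "(e, f) \<in> parcs (network two_cycle_instance)"
      using that(1) by (simp add: event_activity_network_def two_cycle_instance_def)
    ultimately have "((e, t), (f, t)) \<in> parcs (expanded_network two_cycle_instance)"
      unfolding expanded_network_def by auto
    then show ?thesis
      using that assms by (simp add: expanded_line_cycle_def line_cycle_def two_cycle_instance_def)
  qed
  have "set (constant_cycle t) \<subseteq> arcs ?D"
    using line_cycle_one_edge[of "0 :: nat" 1]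
    by (auto simp: constant_cycle_def Let_def line_events_one_edge simp del: One_nat_def intro!: D_arc)
  then have "pre_digraph.awalk ?D ?u (constant_cycle t) ?u"
    using assms by (simp add: pre_digraph.awalk_def pre_digraph.cas.simps sel line_events_one_edge
        constant_cycle_def Let_def del: One_nat_def)
  then have "pre_digraph.cycle ?D (constant_cycle t)"
    unfolding pre_digraph.cycle_def
    by (intro exI[of _ ?u]) (simp add: pre_digraph.awalk_verts.simps sel constant_cycle_def Let_def del: One_nat_def)
  moreover have "card (cycle_nodes (set (constant_cycle t))) = card (pverts (line_cycle [0 :: nat, 1]))"
    by (simp add: cycle_nodes_def constant_cycle_def Let_def line_cycle_def line_events_one_edge)
  ultimately show ?thesis
    by (auto simp: line_cycles_def)
qed

lemma pesp_instance_two_cycle_instance: "pesp_instance two_cycle_instance"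
proof -
  have "pair_pseudo_graph \<lparr> pverts = {0 :: nat, 1}, parcs = {(0, 1), (1, 0)} \<rparr>"
    by unfold_locales (auto simp: symmetric_def sym_def)
  then show ?thesis
    by (auto simp: pesp_instance_def two_cycle_instance_def line_network_def vpath_def vwalk_def)
qed

lemma fractional_optimal_solution:
  "\<exists>(J :: nat pesp) x z. pesp_instance J \<and> nonneg_transfer_weights J \<and> optimal_LP J x z \<and>
     (\<exists>L\<in>lines J. \<not> line_optimal_IP J L x)"
proof -
  let ?J = two_cycle_instance
  let ?L = "[0, 1] :: nat list"
  let ?c = "\<lambda>t. set (constant_cycle t)"
  define x :: "nat arc set \<Rightarrow> rat" where "x c = (if c \<in> {?c 0, ?c 1} then 1 / 2 else 0)" for c
  have ne: "?c 0 \<noteq> ?c 1"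
  proof
    assume "?c 0 = ?c 1"
    \<comment> \<open>The times at the tails tell the two arc sets apart.\<close>
    moreover have "snd ` fst ` ?c t = {t}" for t
      by (simp add: constant_cycle_def Let_def)
    ultimately show False
      by (metis singleton_inject zero_neq_one)
  qed
  have mem: "?c 0 \<in> line_cycles ?J ?L" "?c 1 \<in> line_cycles ?J ?L"
    using constant_cycle_in_line_cycles by auto
  \<comment> \<open>A single line has no transfers, so feasibility only asks for a nonnegative
    \<open>x\<close> with sum 1, and \<open>z\<close> can be 0.\<close>
  have J: "lines ?J = {?L}" "transfers {?L} = {}"
    by (auto simp: two_cycle_instance_def transfers_def)
  have "(\<Sum>c\<in>line_cycles ?J ?L. x c) = (\<Sum>c\<in>{?c 0, ?c 1}. x c)"
    using mem by (intro sum.mono_neutral_right) (auto simp: finite_line_cycles x_def)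
  also have "\<dots> = 1"
    using ne by (simp add: x_def)
  finally have "feasible nonneg_rats ?J x (\<lambda>_. 0)"
    by (auto simp: feasible_def J nonneg_rats_def x_def simp del: One_nat_def)
  moreover have "objective ?J y z = 0" for y z
    by (simp add: objective_def cycle_cost_def arc_cost_def arc_weight_def two_cycle_instance_def)
  ultimately have "optimal_LP ?J x (\<lambda>_. 0)"
    by (simp add: optimal_def)
  moreover have "\<not> line_optimal_IP ?J ?L x"
  proof
    assume "line_optimal_IP ?J ?L x"
    then have "x (?c 0) \<in> \<nat>"
      using mem by (auto simp: line_optimal_def line_feasible_def)
    then obtain n :: nat where "1 / 2 = (of_nat n :: rat)"
      by (auto simp: x_def elim!: Nats_cases)
    then have "of_nat (2 * n) = (of_nat 1 :: rat)"
      by simp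
    then show False
      unfolding of_nat_eq_iff by presburger
  qed
  ultimately show ?thesis
    using pesp_instance_two_cycle_instance J
    by (intro exI[of _ ?J] exI[of _ x] exI[of _ "\<lambda>_. 0"]) (auto simp: nonneg_transfer_weights_def simp del: One_nat_def)
qed

text \<open>That a relaxed optimum need not contain the line optima is an existence claim over
  instances, hence the separate witness \<open>J\<close>. The sign condition guards the two
  estimates with \<open>transfer_bound\<close>.\<close>

theorem mainTheorem6:
  fixes I :: "'v pesp"
  assumes "pesp_instance I"
  shows
    "(\<forall>x z. optimal_LP I x z \<longrightarrow>
        optimal_value_LP I = ereal (real_of_rat
          ((\<Sum>c\<in>all_cycles I. cycle_cost I c * x c) + (\<Sum>a\<in>transfer_arcs I. arc_cost I a * z a))) \<and>
        (\<Sum>c\<in>all_cycles I. cycle_cost I c * x c) =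
          (\<Sum>L\<in>lines I. \<Sum>c\<in>line_cycles I L. cycle_cost I c * x c) \<and>
        (nonneg_transfer_weights I \<longrightarrow>
          (\<Sum>c\<in>all_cycles I. cycle_cost I c * x c) + (\<Sum>a\<in>transfer_arcs I. arc_cost I a * z a)
          \<ge> (\<Sum>L\<in>lines I. \<Sum>c\<in>line_cycles I L. cycle_cost I c * x c) + transfer_bound I))
     \<and> (\<forall>L\<in>lines I. line_optimal_value_LP I L = line_optimal_value_IP I L)
     \<and> (\<exists>(J :: nat pesp) x z. pesp_instance J \<and> nonneg_transfer_weights J \<and> optimal_LP J x z \<and>
          (\<exists>L\<in>lines J. \<not> line_optimal_IP J L x))
     \<and> optimal_value_IP I \<ge> optimal_value_LP I
     \<and> (nonneg_transfer_weights I \<longrightarrow>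
          optimal_value_LP I \<ge>
            (\<Sum>L\<in>lines I. line_optimal_value_IP I L) + ereal (real_of_rat (transfer_bound I)))"
proof (intro conjI allI impI ballI)
  fix x z assume opt: "optimal_LP I x z"
  show "optimal_value_LP I = ereal (real_of_rat
      ((\<Sum>c\<in>all_cycles I. cycle_cost I c * x c) + (\<Sum>a\<in>transfer_arcs I. arc_cost I a * z a)))"
    using optimal_value_eq[OF opt] by (simp add: objective_def)
  show "(\<Sum>c\<in>all_cycles I. cycle_cost I c * x c) =
      (\<Sum>L\<in>lines I. \<Sum>c\<in>line_cycles I L. cycle_cost I c * x c)"
    by (rule sum_all_cycles[OF assms])
  assume "nonneg_transfer_weights I"
  then show "(\<Sum>c\<in>all_cycles I. cycle_cost I c * x c) + (\<Sum>a\<in>transfer_arcs I. arc_cost I a * z a)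
      \<ge> (\<Sum>L\<in>lines I. \<Sum>c\<in>line_cycles I L. cycle_cost I c * x c) + transfer_bound I"
    using feasible_objective_ge[OF assms] opt
    by (simp add: optimal_def objective_def line_objective_def)
\<comment> \<open>Rewriting with \<open>line_optimal_value_integral\<close> also turns the relaxed
  line values in the lower bound into integer ones.\<close>
qed (use optimal_value_LP_ge[OF assms] optimal_value_antimono[OF Nats_nonneg_rats] in
    \<open>simp_all only: line_optimal_value_integral fractional_optimal_solution\<close>)

end
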